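(* For integers $\ell\geq r\geq 3$ and $1\leq k<\frac{\ell^2-1}{2}$, and sufficiently large $n$, $$\mathrm{ex}^{\sum}_r(n,k,K_\ell^{(r)+})= \min\left\{k,\binom{\ell}{2}-1\right\}\binom{n}{r}.$$
   Context: An $r$-graph is an $r$-uniform hypergraph. For a graph $F$, the $r$-expansion $F^{(r)+}$ is the $r$-graph obtained from $F$ by adding, for each edge of $F$, $r-2$ new vertices to that edge, all new vertices being distinct from each other and from $V(F)$; $K_\ell$ is the complete graph on $\ell$ vertices. Given $r$-graphs $\mathcal{H}_1,\dots,\mathcal{H}_k$ on a common vertex set, they contain a rainbow copy of an $r$-graph $\mathcal{F}$ if their union contains a copy of $\mathcal{F}$ whose hyperedges can be assigned to pairwise distinct indices $i$ with each hyperedge belonging to the corresponding $\mathcal{H}_i$. The rainbow hyper-Turán number $\mathrm{ex}^{\sum}_r(n,k,\mathcal{F})$ is the maximum of $\sum_{i=1}^k e(\mathcal{H}_i)$ over all $k$-tuples of $r$-graphs $\mathcal{H}_1,\dots,\mathcal{H}_k$ on the same $n$-vertex set containing no rainbow copy of $\mathcal{F}$. *)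

theory Defs
  imports Complex_Main "HOL-Library.Ramsey"
begin

text \<open>A hypergraph is a pair of a vertex set and an edge set. The library's
  \<open>[V]\<^bsup>r\<^esup>\<close> is the set of all \<open>r\<close>-element subsets of \<open>V\<close>.\<close>

type_synonym 'a hypergraph = "'a set \<times> 'a set set"

abbreviation verts :: "'a hypergraph \<Rightarrow> 'a set" where
  "verts \<equiv> fst"

abbreviation hedges :: "'a hypergraph \<Rightarrow> 'a set set" where
  "hedges \<equiv> snd"

definition r_graph :: "nat \<Rightarrow> 'a hypergraph \<Rightarrow> bool" where
  "r_graph r H \<longleftrightarrow> finite (verts H) \<and> hedges H \<subseteq> [verts H]\<^bsup>r\<^esup>"

definition complete_graph :: "nat \<Rightarrow> nat hypergraph" where
  "complete_graph l = ({..<l}, [{..<l}]\<^bsup>2\<^esup>)"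

text \<open>\<open>New e j\<close> with \<open>j < r - 2\<close> are the vertices added to the edge \<open>e\<close>.\<close>

datatype 'a exp_vertex = Old 'a | New "'a set" nat

definition expansion :: "nat \<Rightarrow> 'a hypergraph \<Rightarrow> 'a exp_vertex hypergraph" where
  "expansion r F =
     (Old ` verts F \<union> (\<Union>e\<in>hedges F. New e ` {..<r - 2}),
      (\<lambda>e. Old ` e \<union> New e ` {..<r - 2}) ` hedges F)"

text \<open>The injection \<open>f\<close> is the copy of \<open>F\<close> and \<open>c\<close> assigns pairwise distinct indices
  from \<open>{1..k}\<close> to its hyperedges.\<close>

definition contains_rainbow_copy ::
    "nat \<Rightarrow> (nat \<Rightarrow> 'b hypergraph) \<Rightarrow> 'a hypergraph \<Rightarrow> bool" where
  "contains_rainbow_copy k H F \<longleftrightarrow>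
     (\<exists>f c. inj_on f (verts F) \<and> inj_on c (hedges F) \<and> c ` hedges F \<subseteq> {1..k} \<and>
        (\<forall>i\<in>{1..k}. f ` verts F \<subseteq> verts (H i)) \<and>
        (\<forall>e\<in>hedges F. f ` e \<in> hedges (H (c e))))"

text \<open>The common vertex set is taken to be \<open>{..<n}\<close>. Only the values of \<open>H\<close> on
  \<open>{1..k}\<close> matter.\<close>

definition rainbow_sums :: "nat \<Rightarrow> nat \<Rightarrow> nat \<Rightarrow> 'a hypergraph \<Rightarrow> nat set" where
  "rainbow_sums r n k F =
     {\<Sum>i=1..k. card (hedges (H i)) | H :: nat \<Rightarrow> nat hypergraph.
        (\<forall>i\<in>{1..k}. r_graph r (H i) \<and> verts (H i) = {..<n}) \<and>
        \<not> contains_rainbow_copy k H F}"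

definition ex_sum :: "nat \<Rightarrow> nat \<Rightarrow> nat \<Rightarrow> 'a hypergraph \<Rightarrow> nat" where
  "ex_sum r n k F = Max (rainbow_sums r n k F)"

text \<open>The maximum is over a finite set, which is nonempty as soon as \<open>F\<close> has a hyperedge.\<close>

lemma finite_rainbow_sums: "finite (rainbow_sums r n k F)"
proof (rule finite_subset)
  show "rainbow_sums r n k F \<subseteq> {..k * (n choose r)}"
  proof
    fix s assume "s \<in> rainbow_sums r n k F"
    then obtain H :: "nat \<Rightarrow> nat hypergraph"
      where s: "s = (\<Sum>i=1..k. card (hedges (H i)))"
        and H: "\<forall>i\<in>{1..k}. r_graph r (H i) \<and> verts (H i) = {..<n}"
      by (auto simp: rainbow_sums_def)
    have "card (hedges (H i)) \<le> n choose r" if "i \<in> {1..k}" for i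
    proof -
      have "hedges (H i) \<subseteq> [{..<n}]\<^bsup>r\<^esup>"
        using H that unfolding r_graph_def by metis
      then have "card (hedges (H i)) \<le> card ([{..<n}]\<^bsup>r\<^esup>)"
        by (intro card_mono finite_imp_finite_nsets) auto
      then show ?thesis by simp
    qed
    then have "s \<le> of_nat (card {1..k}) * (n choose r)"
      unfolding s by (intro sum_bounded_above)
    then show "s \<in> {..k * (n choose r)}" by simp
  qed
qed simp

lemma rainbow_sums_nonempty:
  assumes "hedges F \<noteq> {}"
  shows "rainbow_sums r n k F \<noteq> {}"
proof -
  have "(\<Sum>i=1..k. card (hedges ((\<lambda>i. ({..<n}, {})) i))) \<in> rainbow_sums r n k F"
    unfolding rainbow_sums_def mem_Collect_eq
    by (rule exI[of _ "\<lambda>i. ({..<n}, {})"])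
      (use assms in \<open>auto simp: r_graph_def contains_rainbow_copy_def\<close>)
  then show ?thesis by blast
qed

end

theory Submission imports Defs begin

text \<open>Let \<open>N = l choose 2\<close>. For \<open>k < N\<close> no rainbow copy can exist, so let \<open>k \<ge> N\<close> and suppose that
  the sum exceeds \<open>(N - 1) (n choose r)\<close>. Deleting vertices of low degree, we may assume that every
  vertex has total degree at least \<open>(N - 1) (n - 1 choose r - 1)\<close>, while the excess still gives an
  \<open>r\<close>-set \<open>e0\<close> carrying at least \<open>N\<close> colours. Call a colour robust for a pair of vertices if the
  hyperedges of that colour through the pair cannot be destroyed by boundedly many other vertices.
  Up to a bounded error, every vertex sees \<open>(N - 1) (n - 1)\<close> robust colours, so one can choose
  \<open>x 0, x 1\<close> in \<open>e0\<close> and then greedily \<open>x 2, \<dots>, x (l - 1)\<close> outside \<open>e0\<close> such that \<open>x m\<close> sees at least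
  \<open>m (N - 1)\<close> robust colours towards \<open>x 0, \<dots>, x (m - 1)\<close>. Since \<open>k < (l\<^sup>2 - 1) / 2\<close>, at most \<open>s\<close> of the
  pairs then have at most \<open>s\<close> colours, for every \<open>s < N\<close>, where the pair \<open>x 0, x 1\<close> is given the colours of
  \<open>e0\<close>. Hence the pairs have distinct representative colours, and robustness yields disjoint links.\<close>

section \<open>Counting hyperedges and exchanging sums\<close>

lemma card_nsets_superset:
  assumes "finite W" "Q \<subseteq> W" "card Q \<le> r"
  shows "card {e \<in> [W]\<^bsup>r\<^esup>. Q \<subseteq> e} = (card W - card Q) choose (r - card Q)"
proof -
  have fQ: "finite Q" using assms finite_subset by blast
  have "bij_betw (\<lambda>e. e - Q) {e \<in> [W]\<^bsup>r\<^esup>. Q \<subseteq> e} ([W - Q]\<^bsup>(r - card Q)\<^esup>)"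
  proof (rule bij_betw_byWitness[where f' = "\<lambda>d. d \<union> Q"])
    show "(\<lambda>e. e - Q) ` {e \<in> [W]\<^bsup>r\<^esup>. Q \<subseteq> e} \<subseteq> [W - Q]\<^bsup>(r - card Q)\<^esup>"
      using fQ by (auto simp: nsets_def card_Diff_subset)
    show "(\<lambda>d. d \<union> Q) ` ([W - Q]\<^bsup>(r - card Q)\<^esup>) \<subseteq> {e \<in> [W]\<^bsup>r\<^esup>. Q \<subseteq> e}"
    proof safe
      fix d assume d: "d \<in> [W - Q]\<^bsup>(r - card Q)\<^esup>"
      then have "card (d \<union> Q) = card d + card Q"
        using fQ by (intro card_Un_disjoint) (auto simp: nsets_def)
      then show "d \<union> Q \<in> [W]\<^bsup>r\<^esup>"
        using d fQ assms by (auto simp: nsets_def)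
    qed
  qed (auto simp: nsets_def)
  then have "card {e \<in> [W]\<^bsup>r\<^esup>. Q \<subseteq> e} = card (W - Q) choose (r - card Q)"
    by (metis bij_betw_same_card card_nsets)
  then show ?thesis using fQ assms by (simp add: card_Diff_subset)
qed

lemma sum_card_swap:
  assumes "finite E" "finite I" "\<And>e. e \<in> E \<Longrightarrow> C e \<subseteq> I"
  shows "(\<Sum>e\<in>E. card (C e)) = (\<Sum>i\<in>I. card {e \<in> E. i \<in> C e})"
proof -
  have "(\<Sum>e\<in>E. card (C e)) = (\<Sum>e\<in>E. card {i \<in> I. i \<in> C e})"
    using assms(3) by (intro sum.cong arg_cong[where f = card]) auto
  also have "\<dots> = (\<Sum>i\<in>I. card {e \<in> E. i \<in> C e})"
    by (rule sum_multicount_gen) (use assms in auto)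
  finally show ?thesis .
qed

section \<open>Systems of distinct representatives\<close>

text \<open>A greedy substitute for Hall's theorem: the hypothesis says that the i-th smallest set
  has at least i elements. Taking \<open>s = card E - 1\<close> yields a set with at least
  \<open>card E\<close> elements; it can be served last, since the other sets occupy at most
  \<open>card E - 1\<close> representatives.\<close>

lemma distinct_representatives:
  assumes "finite E" "\<And>e. e \<in> E \<Longrightarrow> finite (C e)"
    and "\<And>s. s < card E \<Longrightarrow> card {e \<in> E. card (C e) \<le> s} \<le> s"
  shows "\<exists>f. inj_on f E \<and> (\<forall>e\<in>E. f e \<in> C e)"
  using assms
proof (induction "card E" arbitrary: E)
  case 0
  then show ?case by auto
next
  case (Suc n)
  have "\<not> E \<subseteq> {e \<in> E. card (C e) \<le> n}"
  proof
    assume "E \<subseteq> {e \<in> E. card (C e) \<le> n}"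
    then have "card E \<le> card {e \<in> E. card (C e) \<le> n}"
      using Suc.prems(1) by (intro card_mono) auto
    with Suc.prems(3)[of n] Suc.hyps(2) show False by simp
  qed
  then obtain e where e: "e \<in> E" "n < card (C e)" using not_le by blast
  have cE: "card (E - {e}) = n" using e Suc.hyps(2) Suc.prems(1) by simp
  have "\<exists>f. inj_on f (E - {e}) \<and> (\<forall>e'\<in>E - {e}. f e' \<in> C e')"
  proof (rule Suc.hyps(1))
    fix s assume s: "s < card (E - {e})"
    have "card {e' \<in> E - {e}. card (C e') \<le> s} \<le> card {e' \<in> E. card (C e') \<le> s}"
      using Suc.prems(1) by (intro card_mono) auto
    also have "\<dots> \<le> s" using Suc.prems(3) s cE Suc.hyps(2) by simp
    finally show "card {e' \<in> E - {e}. card (C e') \<le> s} \<le> s" .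
  qed (use cE Suc.prems in auto)
  then obtain f where f: "inj_on f (E - {e})" "\<forall>e'\<in>E - {e}. f e' \<in> C e'" by blast
  have "card (f ` (E - {e})) < card (C e)"
    using e(2) cE card_image_le[of "E - {e}" f] Suc.prems(1) by simp
  then have "\<not> C e \<subseteq> f ` (E - {e})"
    using Suc.prems(1) by (metis card_mono finite_Diff finite_imageI not_le)
  then obtain c where c: "c \<in> C e" "c \<notin> f ` (E - {e})" by blast
  have "inj_on (f(e := c)) E"
    using f(1) c(2) by (auto simp: inj_on_def)
  moreover have "\<forall>e'\<in>E. (f(e := c)) e' \<in> C e'" using f(2) c(1) by auto
  ultimately show ?case by blast
qed

text \<open>Count deficits \<open>k - w a\<close>: their total is at most
  \<open>card A * (k - M)\<close>, and every element of weight at most \<open>s\<close> contributes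
  at least \<open>k - s\<close>.\<close>

lemma few_small_weights:
  fixes w :: "'a \<Rightarrow> nat"
  assumes "finite A" "\<And>a. a \<in> A \<Longrightarrow> w a \<le> k" "s \<le> k"
    and "card A * M \<le> sum w A"
  shows "card {a \<in> A. w a \<le> s} * (k - s) \<le> card A * (k - M)"
proof -
  let ?c = "card {a \<in> A. w a \<le> s}"
  have "card {a \<in> A. w a \<le> s} * (k - s) = (\<Sum>a\<in>{a \<in> A. w a \<le> s}. k - s)" by simp
  also have "\<dots> \<le> (\<Sum>a\<in>{a \<in> A. w a \<le> s}. k - w a)" by (intro sum_mono) auto
  also have "\<dots> \<le> (\<Sum>a\<in>A. k - w a)" using assms(1) by (intro sum_mono2) auto
  also have "\<dots> = card A * k - sum w A"
    using assms(2) by (simp add: sum_subtractf_nat)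
  also have "\<dots> \<le> card A * (k - M)"
    using assms(4) by (simp add: diff_mult_distrib2)
  finally show ?thesis .
qed

text \<open>Here \<open>c m\<close> stands for the number of pairs \<open>{i, m}\<close> with
  \<open>i < m\<close> that have at most \<open>s\<close> colours, so the conclusion is what
  \<open>distinct_representatives\<close> asks for. The bound on \<open>c m * (k - s)\<close> is
  that of \<open>few_small_weights\<close> for \<open>M = (l choose 2) - 1\<close>, where
  \<open>k - M = q\<close>; and \<open>2 * q \<le> l\<close> is the integer form of the upper bound
  on \<open>k\<close>.\<close>

lemma few_small_weights_total:
  fixes c :: "nat \<Rightarrow> nat"
  assumes l: "l \<ge> 3" and k: "k = (l choose 2) - 1 + q" and q: "2 * q \<le> l" "q \<ge> 1"
    and s: "s < (l choose 2)"
    and c_le: "\<And>m. m \<in> {2..<l} \<Longrightarrow> c m \<le> m"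
    and c: "\<And>m. m \<in> {2..<l} \<Longrightarrow> c m * (k - s) \<le> m * q"
  shows "(\<Sum>m\<in>{2..<l}. c m) \<le> s"
proof -
  define N where "N = (l choose 2)"
  have sumN: "(\<Sum>m\<in>{2..<l}. m) = N - 1"
  proof -
    have "{..<l} = {0,1} \<union> {2..<l}" using l by auto
    moreover have "(\<Sum>m\<in>{0,1} \<union> {2..<l}. m) = (\<Sum>m\<in>{0,1::nat}. m) + (\<Sum>m\<in>{2..<l}. m)"
      by (intro sum.union_disjoint) auto
    ultimately have "(\<Sum>m<l. m) = 1 + (\<Sum>m\<in>{2..<l}. m)" by simp
    moreover have "(\<Sum>m<l. m) = N"
      unfolding N_def choose_two lessThan_atLeast0 using Sum_Ico_nat[of 0 l] by simp
    ultimately show ?thesis by simp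
  qed
  have N2: "2 * N = l * (l - 1)"
    unfolding N_def choose_two by (intro dvd_mult_div_cancel) (cases l; auto)
  have Npos: "N \<ge> 3"
    using mult_le_mono[of 3 l 2 "l - 1"] l N2 by linarith
  have kN: "k = N - 1 + q" using k N_def by simp
  have sN: "s < N" using s N_def by simp
  have lq: "(l - 1) * q \<le> N"
  proof -
    have "(l - 1) * (2 * q) \<le> (l - 1) * l" using q by (intro mult_left_mono) auto
    then have "2 * ((l - 1) * q) \<le> 2 * N" unfolding N2 by (simp only: ac_simps)
    then show ?thesis by simp
  qed
  consider "s = N - 1" | "q \<le> s" "s < N - 1" | "s < q" using sN by linarith
  then show ?thesis
    \<comment> \<open>Summing \<open>c m * d \<le> m * q\<close> with \<open>d = k - s\<close> reduces the claim to \<open>(d - q) * (N - 1 - d) \<ge> 0\<close>. This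
      fails for \<open>s < q\<close>, where instead all \<open>c m\<close> vanish, except possibly \<open>c (l - 1) = 1\<close>.\<close>
  proof cases
    case 1
    then show ?thesis using sum_mono[of "{2..<l}" c "\<lambda>m. m", OF c_le] sumN by simp
  next
    case 2
    define d where "d = k - s"
    have d: "d + s = N - 1 + q" "d > q" "d \<le> N - 1" using 2 kN by (auto simp: d_def)
    have "(\<Sum>m\<in>{2..<l}. c m) * d \<le> (\<Sum>m\<in>{2..<l}. m * q)"
      unfolding sum_distrib_right d_def using c by (intro sum_mono) auto
    also have "\<dots> = (N - 1) * q" using sumN by (simp flip: sum_distrib_right)
    also have "\<dots> \<le> s * d"
    proof -
      have "(int d - int q) * (int (N - 1) - int d) \<ge> 0"
        using d(2,3) by (intro mult_nonneg_nonneg) linarith+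
      moreover have s_eq: "int s = int (N - 1) + int q - int d" using d(1) by linarith
      ultimately have "int (N - 1) * int q \<le> int s * int d"
        unfolding s_eq by (simp only: algebra_simps)
      then show ?thesis by (metis of_nat_le_iff of_nat_mult)
    qed
    finally show ?thesis using d(2) by simp
  next
    case 3
    have d: "k - s \<ge> N" using 3 kN Npos by linarith
    have zero: "c m = 0" if "m \<in> {2..<l}" "m * q < N" for m
    proof (rule ccontr)
      assume "c m \<noteq> 0"
      then have "N \<le> c m * (k - s)" using d by (metis le_trans mult_le_mono1 nat_mult_1 One_nat_def Suc_leI gr0I)
      with c[OF that(1)] that(2) show False by simp
    qed
    have zero': "c m = 0" if "m \<in> {2..<l}" "m \<noteq> l - 1" for m
    proof (rule zero[OF that(1)])
      have "m < l - 1" using that by auto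
      then have "m * q < (l - 1) * q" using q by simp
      from less_le_trans[OF this lq] show "m * q < N" .
    qed
    have "(\<Sum>m\<in>{2..<l}. c m) = (\<Sum>m\<in>{l - 1}. c m)"
      using l zero' by (intro sum.mono_neutral_right) auto
    then have sum_eq: "(\<Sum>m\<in>{2..<l}. c m) = c (l - 1)" by simp
    have mem: "l - 1 \<in> {2..<l}" using l by auto
    show ?thesis
    proof (cases "c (l - 1) = 0")
      case True then show ?thesis using sum_eq by simp
    next
      case False
      \<comment> \<open>A nonzero \<open>c (l - 1)\<close> forces equality in \<open>lq\<close>,
        hence \<open>l = 2 * q\<close> and \<open>q \<ge> 2\<close>. Then
        \<open>k - s \<le> N\<close> gives \<open>s \<ge> q - 1 \<ge> 1\<close>, which leaves room
        for the single exception.\<close>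
      have eq: "(l - 1) * q = N" "k - s \<le> N" 
      proof -
        show "(l - 1) * q = N" using zero[OF mem] False lq by linarith
        have "k - s \<le> c (l - 1) * (k - s)" using False by simp
        also have "\<dots> \<le> N" using c[OF mem] lq by linarith
        finally show "k - s \<le> N" .
      qed
      have "c (l - 1) * N \<le> N"
        using c[OF mem] lq d by (metis eq(1) eq(2) le_antisym)
      then have c1: "c (l - 1) \<le> 1" using Npos by simp
      have "(l - 1) * (2 * q) = 2 * ((l - 1) * q)" by (simp only: ac_simps)
      then have "(l - 1) * (2 * q) = (l - 1) * l" unfolding eq(1) N2 by (simp only: mult.commute)
      then have "2 * q = l" using mult_left_cancel[of "l - 1" "2 * q" l] l by linarith
      then have "q \<ge> 2" using l by simp
      moreover have "s \<ge> q - 1" using eq(2) kN Npos 3 by linarith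
      ultimately show ?thesis using sum_eq c1 by simp
    qed
  qed
qed

section \<open>Colours that a pair keeps after deleting few vertices\<close>

text \<open>Quantifying over \<open>Z\<close> serves both directions: a robust colour offers a
  hyperedge through \<open>P\<close> that avoids the vertices used so far, while a colour that fails
  comes with a small set meeting all its hyperedges through \<open>P\<close>. Vertices of
  \<open>P\<close> are excluded from \<open>Z\<close> because no hyperedge through \<open>P\<close>
  could avoid them.\<close>

definition robust_colours ::
    "('a set \<Rightarrow> 'c set) \<Rightarrow> nat \<Rightarrow> nat \<Rightarrow> 'a set \<Rightarrow> 'a set \<Rightarrow> 'c set" where
  "robust_colours C r B W P =
     {c. \<forall>Z. finite Z \<and> card Z \<le> B \<and> Z \<inter> P = {} \<longrightarrow>
        (\<exists>e\<in>[W]\<^bsup>r\<^esup>. P \<subseteq> e \<and> e \<inter> Z = {} \<and> c \<in> C e)}"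

lemma robust_colours_subset:
  assumes "\<And>e. C e \<subseteq> I"
  shows "robust_colours C r B W P \<subseteq> I"
proof
  fix c assume "c \<in> robust_colours C r B W P"
  then have "finite Z \<and> card Z \<le> B \<and> Z \<inter> P = {} \<longrightarrow> (\<exists>e\<in>[W]\<^bsup>r\<^esup>. P \<subseteq> e \<and> e \<inter> Z = {} \<and> c \<in> C e)" for Z
    by (simp add: robust_colours_def)
  from this[of "{}"] obtain e where "c \<in> C e" by auto
  then show "c \<in> I" using assms by blast
qed

text \<open>A set \<open>Z\<close> witnessing the failure meets every hyperedge of colour
  \<open>c\<close> through \<open>P\<close>, so each of them contains \<open>P\<close> and one of at
  most \<open>B\<close> further vertices. The bound is of order \<open>r - 3\<close> in
  \<open>card W\<close>, one below the number of \<open>r\<close>-sets through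
  \<open>P\<close>.\<close>

lemma card_not_robust:
  assumes "finite W" "P \<subseteq> W" "card P = 2" "r \<ge> 3" "c \<notin> robust_colours C r B W P"
  shows "card {e \<in> [W]\<^bsup>r\<^esup>. P \<subseteq> e \<and> c \<in> C e} \<le> B * ((card W - 3) choose (r - 3))"
proof -
  obtain Z where Z: "finite Z" "card Z \<le> B" "Z \<inter> P = {}"
    "\<And>e. e \<in> [W]\<^bsup>r\<^esup> \<Longrightarrow> P \<subseteq> e \<Longrightarrow> c \<in> C e \<Longrightarrow> e \<inter> Z \<noteq> {}"
    using assms(5) unfolding robust_colours_def mem_Collect_eq by meson
  have fin: "finite P" using assms finite_subset by blast
  have *: "card {e \<in> [W]\<^bsup>r\<^esup>. insert z P \<subseteq> e} = (card W - 3) choose (r - 3)" if "z \<in> Z \<inter> W" for z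
  proof -
    have "card (insert z P) = 3" using that Z(3) fin assms(3) by (subst card_insert_disjoint) auto
    then show ?thesis using card_nsets_superset[of W "insert z P" r] that assms by auto
  qed
  have "{e \<in> [W]\<^bsup>r\<^esup>. P \<subseteq> e \<and> c \<in> C e} \<subseteq> (\<Union>z\<in>Z \<inter> W. {e \<in> [W]\<^bsup>r\<^esup>. insert z P \<subseteq> e})"
  proof
    fix e assume e: "e \<in> {e \<in> [W]\<^bsup>r\<^esup>. P \<subseteq> e \<and> c \<in> C e}"
    then obtain z where "z \<in> e" "z \<in> Z" using Z(4) by blast
    moreover from this e have "z \<in> W" by (auto simp: nsets_def)
    ultimately show "e \<in> (\<Union>z\<in>Z \<inter> W. {e \<in> [W]\<^bsup>r\<^esup>. insert z P \<subseteq> e})" using e by auto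
  qed
  then have "card {e \<in> [W]\<^bsup>r\<^esup>. P \<subseteq> e \<and> c \<in> C e} \<le> card (\<Union>z\<in>Z \<inter> W. {e \<in> [W]\<^bsup>r\<^esup>. insert z P \<subseteq> e})"
    using Z(1) assms(1) by (intro card_mono) (auto simp: finite_imp_finite_nsets)
  also have "\<dots> \<le> (\<Sum>z\<in>Z \<inter> W. card {e \<in> [W]\<^bsup>r\<^esup>. insert z P \<subseteq> e})"
    using Z(1) by (intro card_UN_le) auto
  also have "\<dots> = card (Z \<inter> W) * ((card W - 3) choose (r - 3))"
    using * by simp
  also have "\<dots> \<le> B * ((card W - 3) choose (r - 3))"
    using Z(1,2) card_mono[of Z "Z \<inter> W"] by (intro mult_right_mono) auto
  finally show ?thesis .
qed

text \<open>Count by colours: a robust colour may occur on all \<open>r\<close>-sets through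
  \<open>P\<close>, any other one is bounded by \<open>card_not_robust\<close>.\<close>

lemma pair_weight_le:
  assumes "finite W" "P \<subseteq> W" "card P = 2" "r \<ge> 3" "finite I" "\<And>e. C e \<subseteq> I"
  shows "(\<Sum>e\<in>{e \<in> [W]\<^bsup>r\<^esup>. P \<subseteq> e}. card (C e))
    \<le> card (robust_colours C r B W P) * ((card W - 2) choose (r - 2))
      + card I * (B * ((card W - 3) choose (r - 3)))"
proof -
  let ?R = "robust_colours C r B W P" and ?E = "{e \<in> [W]\<^bsup>r\<^esup>. P \<subseteq> e}"
  have fE: "finite ?E" using assms(1) by (simp add: finite_imp_finite_nsets)
  have RI: "?R \<subseteq> I" by (rule robust_colours_subset) (rule assms)
  have cE: "card ?E = (card W - 2) choose (r - 2)"
    using card_nsets_superset[of W P r] assms by simp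
  have "(\<Sum>e\<in>?E. card (C e)) = (\<Sum>i\<in>I. card {e \<in> ?E. i \<in> C e})"
    by (rule sum_card_swap) (use fE assms in auto)
  also have "\<dots> = (\<Sum>i\<in>?R. card {e \<in> ?E. i \<in> C e}) + (\<Sum>i\<in>I - ?R. card {e \<in> ?E. i \<in> C e})"
    using sum.subset_diff[OF RI assms(5)] by (simp add: add.commute)
  also have "(\<Sum>i\<in>?R. card {e \<in> ?E. i \<in> C e}) \<le> card ?R * ((card W - 2) choose (r - 2))"
    using fE by (intro sum_bounded_above[where 'a=nat, simplified] order_trans[OF card_mono eq_refl[OF cE]]) auto
  also have "(\<Sum>i\<in>I - ?R. card {e \<in> ?E. i \<in> C e}) \<le> card (I - ?R) * (B * ((card W - 3) choose (r - 3)))"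
  proof (intro sum_bounded_above[where 'a=nat, simplified])
    fix i assume "i \<in> I - ?R"
    then show "card {e \<in> ?E. i \<in> C e} \<le> B * ((card W - 3) choose (r - 3))"
      using card_not_robust[of W P r i C B] assms by (simp add: conj_assoc)
  qed
  also have "\<dots> \<le> card I * (B * ((card W - 3) choose (r - 3)))"
    using assms(5) by (intro mult_right_mono card_mono) auto
  finally show ?thesis by simp
qed

lemma degree_double_count:
  fixes \<mu> :: "'a set \<Rightarrow> nat"
  assumes "finite W"
  shows "(r - 1) * (\<Sum>e\<in>{e \<in> [W]\<^bsup>r\<^esup>. u \<in> e}. \<mu> e)
    = (\<Sum>v\<in>W - {u}. \<Sum>e\<in>{e \<in> [W]\<^bsup>r\<^esup>. {u,v} \<subseteq> e}. \<mu> e)"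
proof -
  let ?E = "{e \<in> [W]\<^bsup>r\<^esup>. u \<in> e}"
  have fE: "finite ?E" using assms by (simp add: finite_imp_finite_nsets)
  have "(\<Sum>v\<in>W - {u}. \<Sum>e\<in>{e \<in> [W]\<^bsup>r\<^esup>. {u,v} \<subseteq> e}. \<mu> e)
      = (\<Sum>v\<in>W - {u}. \<Sum>e\<in>{e \<in> ?E. v \<in> e}. \<mu> e)"
    by (intro sum.cong) auto
  also have "\<dots> = (\<Sum>e\<in>?E. \<Sum>v\<in>{v \<in> W - {u}. v \<in> e}. \<mu> e)"
    using sum.swap_restrict[of "W - {u}" ?E "\<lambda>v e. \<mu> e" "\<lambda>v e. v \<in> e"] fE assms by simp
  also have "\<dots> = (\<Sum>e\<in>?E. (r - 1) * \<mu> e)"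
  proof (rule sum.cong)
    fix e assume e: "e \<in> ?E"
    then have "{v \<in> W - {u}. v \<in> e} = e - {u}" by (auto simp: nsets_def)
    moreover have "card (e - {u}) = r - 1" using e by (auto simp: nsets_def)
    ultimately show "(\<Sum>v\<in>{v \<in> W - {u}. v \<in> e}. \<mu> e) = (r - 1) * \<mu> e" by simp
  qed simp
  finally show ?thesis by (simp add: sum_distrib_left)
qed

text \<open>Double counting turns the degree of \<open>u\<close> into a sum over pairs
  \<open>{u, v}\<close>, to which \<open>pair_weight_le\<close> applies. After division by the
  number of \<open>r\<close>-sets through a pair, the colours that are not robust cost only a
  constant, independent of \<open>card W\<close>.\<close>

lemma robust_degree_ge:
  assumes "finite W" "u \<in> W" "r \<ge> 3" "card W \<ge> r" "finite I" "\<And>e. C e \<subseteq> I"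
    and deg: "M * ((card W - 1) choose (r - 1)) \<le> (\<Sum>e\<in>{e \<in> [W]\<^bsup>r\<^esup>. u \<in> e}. card (C e))"
  shows "M * (card W - 1) \<le> (\<Sum>v\<in>W - {u}. card (robust_colours C r B W {u,v})) + 2 * card I * B * r"
proof -
  let ?R = "\<lambda>v. card (robust_colours C r B W {u,v})"
  define n where "n = card W"
  define b where "b = (n - 2) choose (r - 2)"
  define b' where "b' = (n - 3) choose (r - 3)"
  have n: "n \<ge> 3" "n \<ge> r" using assms n_def by auto
  have bpos: "b > 0" using n unfolding b_def by simp
  have eq1: "(r - 1) * ((n - 1) choose (r - 1)) = (n - 1) * b"
    using binomial_absorption[of "r - 2" "n - 1"] assms(3) n
    by (simp add: b_def Suc_diff_Suc numeral_2_eq_2)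
  have eq2: "(r - 2) * b = (n - 2) * b'"
    using binomial_absorption[of "r - 3" "n - 2"] assms(3) n
    by (simp add: b_def b'_def Suc_diff_Suc numeral_3_eq_3 numeral_2_eq_2)
  \<comment> \<open>Each of the \<open>n - 1\<close> pairs loses a multiple of \<open>b'\<close>. By
    \<open>eq2\<close> the ratio of \<open>b'\<close> to \<open>b\<close> is
    \<open>(r - 2) / (n - 2)\<close>, so the total loss is a bounded multiple of
    \<open>b\<close>.\<close>
  have "(n - 1) * b' \<le> 2 * (n - 2) * b'" using n by (intro mult_right_mono) auto
  also have "\<dots> = 2 * (r - 2) * b" using eq2 by simp
  also have "\<dots> \<le> 2 * r * b" by simp
  finally have b': "(n - 1) * b' \<le> 2 * r * b" .
  have "(M * (n - 1)) * b = (r - 1) * (M * ((n - 1) choose (r - 1)))"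
    using eq1 by (metis mult.assoc mult.left_commute)
  also have "\<dots> \<le> (r - 1) * (\<Sum>e\<in>{e \<in> [W]\<^bsup>r\<^esup>. u \<in> e}. card (C e))"
    using deg unfolding n_def by (intro mult_left_mono) auto
  also have "\<dots> = (\<Sum>v\<in>W - {u}. \<Sum>e\<in>{e \<in> [W]\<^bsup>r\<^esup>. {u,v} \<subseteq> e}. card (C e))"
    by (rule degree_double_count) fact
  also have "\<dots> \<le> (\<Sum>v\<in>W - {u}. ?R v * b + card I * (B * b'))"
    unfolding b_def b'_def n_def
    by (intro sum_mono pair_weight_le) (use assms in auto)
  also have "\<dots> = (\<Sum>v\<in>W - {u}. ?R v) * b + (n - 1) * b' * (card I * B)"
    using assms(1,2) by (simp add: sum.distrib sum_distrib_right n_def)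
  also have "\<dots> \<le> (\<Sum>v\<in>W - {u}. ?R v) * b + 2 * r * b * (card I * B)"
    using b' by (intro add_left_mono mult_right_mono) auto
  also have "\<dots> = ((\<Sum>v\<in>W - {u}. ?R v) + 2 * card I * B * r) * b"
    by (simp add: algebra_simps)
  finally show ?thesis using bpos by (simp add: n_def)
qed

text \<open>Averaging with an integrality gap: if every \<open>v\<close> outside \<open>Z\<close>
  failed, each would fall short of \<open>card K * M\<close> by at least 1, a total loss of
  \<open>card (W - Z)\<close>. By \<open>robust_degree_ge\<close> the loss is bounded by a constant,
  which \<open>big\<close> exceeds.\<close>

lemma robust_extension:
  assumes "finite W" "K \<subseteq> W" "K \<subseteq> Z" "finite Z" "K \<noteq> {}" "r \<ge> 3" "card W \<ge> r" "finite I" "\<And>e. C e \<subseteq> I"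
    and deg: "\<And>u. u \<in> W \<Longrightarrow>
      M * ((card W - 1) choose (r - 1)) \<le> (\<Sum>e\<in>{e \<in> [W]\<^bsup>r\<^esup>. u \<in> e}. card (C e))"
    and big: "card W > card Z + card K * (M + 2 * card I * B * r + card Z * card I)"
  shows "\<exists>v\<in>W - Z. card K * M \<le> (\<Sum>u\<in>K. card (robust_colours C r B W {u,v}))"
proof (rule ccontr)
  let ?R = "\<lambda>u v. card (robust_colours C r B W {u,v})"
  \<comment> \<open>Error per vertex of \<open>K\<close>: the loss from
    \<open>robust_degree_ge\<close> plus all colours towards vertices of \<open>Z\<close>.\<close>
  define D where "D = 2 * card I * B * r + card Z * card I"
  assume "\<not> ?thesis"
  then have small: "(\<Sum>u\<in>K. ?R u v) + 1 \<le> card K * M" if "v \<in> W - Z" for v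
    using that by (auto simp: not_le Suc_le_eq)
  have fK: "finite K" using assms finite_subset by blast
  have R_le: "?R u v \<le> card I" for u v
    using robust_colours_subset[of C I r B W "{u,v}"] assms(8,9) by (intro card_mono) auto
  have row: "M * (card W - 1) \<le> (\<Sum>v\<in>W - Z. ?R u v) + D" if u: "u \<in> K" for u
  proof -
    have "(\<Sum>v\<in>W - {u}. ?R u v) \<le> (\<Sum>v\<in>(W - Z) \<union> Z. ?R u v)"
      using assms by (intro sum_mono2) auto
    also have "\<dots> = (\<Sum>v\<in>W - Z. ?R u v) + (\<Sum>v\<in>Z. ?R u v)"
      using assms by (intro sum.union_disjoint) auto
    also have "(\<Sum>v\<in>Z. ?R u v) \<le> card Z * card I"
      using sum_bounded_above[of Z "?R u" "card I"] R_le by simp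
    finally have "(\<Sum>v\<in>W - {u}. ?R u v) \<le> (\<Sum>v\<in>W - Z. ?R u v) + card Z * card I" by simp
    moreover have "M * (card W - 1) \<le> (\<Sum>v\<in>W - {u}. ?R u v) + 2 * card I * B * r"
      using assms u by (intro robust_degree_ge) auto
    ultimately show ?thesis by (simp add: D_def)
  qed
  have "card K * (M * (card W - 1)) \<le> (\<Sum>u\<in>K. (\<Sum>v\<in>W - Z. ?R u v) + D)"
    using sum_mono[OF row] by simp
  also have "\<dots> = (\<Sum>v\<in>W - Z. \<Sum>u\<in>K. ?R u v) + card K * D"
    using sum.swap[of ?R "W - Z" K] by (simp add: sum.distrib)
  finally have 1: "card K * (M * (card W - 1)) \<le> (\<Sum>v\<in>W - Z. \<Sum>u\<in>K. ?R u v) + card K * D" .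
  have "(\<Sum>v\<in>W - Z. (\<Sum>u\<in>K. ?R u v) + 1) \<le> card (W - Z) * (card K * M)"
    using sum_bounded_above[of "W - Z" "\<lambda>v. (\<Sum>u\<in>K. ?R u v) + 1"] small by simp
  then have 2: "(\<Sum>v\<in>W - Z. \<Sum>u\<in>K. ?R u v) + card (W - Z) \<le> card (W - Z) * (card K * M)"
    unfolding sum.distrib by simp
  have "card W \<le> card Z + card (W - Z)"
    using diff_card_le_card_Diff[OF assms(4), of W] by linarith
  then have 3: "card (W - Z) > card K * (M + D)"
    using big by (simp add: D_def algebra_simps)
  have "card (W - Z) * (card K * M) \<le> card W * (card K * M)"
    using assms(1) by (intro mult_right_mono card_mono) auto
  also have "\<dots> = card K * (M * (card W - 1)) + card K * M"
  proof -
    have "card W = (card W - 1) + 1" using big by simp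
    then show ?thesis by (metis (no_types, lifting) add_mult_distrib mult.commute mult.left_commute mult_1)
  qed
  finally show False using 1 2 3 by (simp add: algebra_simps)
qed

section \<open>Passing to a vertex set of large minimum degree\<close>

lemma high_min_degree_subset:
  fixes \<mu> :: "'a set \<Rightarrow> nat"
  assumes "finite W" "r \<ge> 1" "\<And>e. \<mu> e \<le> k"
    and "card W \<ge> n0" "card W + j \<ge> n0 + k * (n0 choose r)"
    and "M * (card W choose r) + j < (\<Sum>e\<in>[W]\<^bsup>r\<^esup>. \<mu> e)"
    \<comment> \<open>Each deletion of a vertex of low degree increases the excess \<open>j\<close>, which cannot grow beyond
      \<open>k * (n0 choose r)\<close> on \<open>n0\<close> vertices.\<close>
  shows "\<exists>W'\<subseteq>W. card W' \<ge> n0 \<and> M * (card W' choose r) < (\<Sum>e\<in>[W']\<^bsup>r\<^esup>. \<mu> e) \<and>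
    (\<forall>u\<in>W'. M * ((card W' - 1) choose (r - 1)) \<le> (\<Sum>e\<in>{e \<in> [W']\<^bsup>r\<^esup>. u \<in> e}. \<mu> e))"
  using assms
proof (induction "card W" arbitrary: W j rule: less_induct)
  case less
  show ?case
  proof (cases "\<forall>u\<in>W. M * ((card W - 1) choose (r - 1)) \<le> (\<Sum>e\<in>{e \<in> [W]\<^bsup>r\<^esup>. u \<in> e}. \<mu> e)")
    case True
    then show ?thesis using less.prems by (intro exI[of _ W]) auto
  next
    case False
    then obtain u where u: "u \<in> W"
      "(\<Sum>e\<in>{e \<in> [W]\<^bsup>r\<^esup>. u \<in> e}. \<mu> e) < M * ((card W - 1) choose (r - 1))" by (auto simp: not_le)
    have cW: "card W = Suc (card (W - {u}))" using u(1) less.prems(1) by (metis card.remove)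
    have "[W]\<^bsup>r\<^esup> = [W - {u}]\<^bsup>r\<^esup> \<union> {e \<in> [W]\<^bsup>r\<^esup>. u \<in> e}" by (auto simp: nsets_def)
    moreover have "(\<Sum>e\<in>[W - {u}]\<^bsup>r\<^esup> \<union> {e \<in> [W]\<^bsup>r\<^esup>. u \<in> e}. \<mu> e)
        = (\<Sum>e\<in>[W - {u}]\<^bsup>r\<^esup>. \<mu> e) + (\<Sum>e\<in>{e \<in> [W]\<^bsup>r\<^esup>. u \<in> e}. \<mu> e)"
      using less.prems(1) by (intro sum.union_disjoint) (auto simp: finite_imp_finite_nsets nsets_def)
    ultimately have split: "(\<Sum>e\<in>[W]\<^bsup>r\<^esup>. \<mu> e)
        = (\<Sum>e\<in>[W - {u}]\<^bsup>r\<^esup>. \<mu> e) + (\<Sum>e\<in>{e \<in> [W]\<^bsup>r\<^esup>. u \<in> e}. \<mu> e)" by simp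
    obtain r' where r': "r = Suc r'" using less.prems(2) by (cases r) auto
    have "M * (card W choose r) = M * (card (W - {u}) choose r) + M * ((card W - 1) choose (r - 1))"
      unfolding cW r' by (simp add: algebra_simps)
    then have excess: "M * (card (W - {u}) choose r) + Suc j < (\<Sum>e\<in>[W - {u}]\<^bsup>r\<^esup>. \<mu> e)"
      using less.prems(6) split u(2) by linarith
    \<comment> \<open>A deletion leaves \<open>card W + j\<close> unchanged, so at
      \<open>card W = n0\<close> the excess \<open>j\<close> would be at least
      \<open>k * (n0 choose r)\<close>, the largest possible total weight.\<close>
    have "card W \<noteq> n0"
    proof
      assume n0: "card W = n0"
      have "(\<Sum>e\<in>[W]\<^bsup>r\<^esup>. \<mu> e) \<le> k * (n0 choose r)"
        using sum_bounded_above[of "[W]\<^bsup>r\<^esup>" \<mu> k] less.prems(3) n0 by (simp add: mult.commute)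
      with less.prems(5,6) n0 show False by simp
    qed
    then have "\<exists>W'\<subseteq>W - {u}. card W' \<ge> n0 \<and> M * (card W' choose r) < (\<Sum>e\<in>[W']\<^bsup>r\<^esup>. \<mu> e) \<and>
      (\<forall>u\<in>W'. M * ((card W' - 1) choose (r - 1)) \<le> (\<Sum>e\<in>{e \<in> [W']\<^bsup>r\<^esup>. u \<in> e}. \<mu> e))"
    proof (intro less.hyps[of _ "Suc j"])
      show "card (W - {u}) < card W" using cW by simp
      show "n0 \<le> card (W - {u})" using less.prems(4) cW \<open>card W \<noteq> n0\<close> by linarith
      show "n0 + k * (n0 choose r) \<le> card (W - {u}) + Suc j" using less.prems(5) cW by linarith
      show "finite (W - {u})" using less.prems(1) by simp
    qed (use less.prems(2,3) excess in auto)
    then show ?thesis by blast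
  qed
qed

section \<open>Finding and embedding the rainbow expansion\<close>

text \<open>Greedy choice: the next hyperedge has to avoid \<open>Y\<close> and all earlier
  hyperedges, apart from \<open>g p\<close>. These are at most \<open>card Y + r * card S\<close>
  vertices, within the allowance \<open>B\<close>.\<close>

lemma disjoint_links:
  assumes "finite S" "finite Y" "card Y + r * card S \<le> B" "\<And>p. p \<in> S \<Longrightarrow> g p \<subseteq> Y"
    and "\<And>p Z. p \<in> S \<Longrightarrow> finite Z \<Longrightarrow> card Z \<le> B \<Longrightarrow> Z \<inter> g p = {} \<Longrightarrow>
      \<exists>e\<in>[W]\<^bsup>r\<^esup>. g p \<subseteq> e \<and> e \<inter> Z = {} \<and> Q p e"
  shows "\<exists>h. \<forall>p\<in>S. h p \<in> [W]\<^bsup>r\<^esup> \<and> Q p (h p) \<and> h p \<inter> Y = g p \<and>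
    (\<forall>q\<in>S. p \<noteq> q \<longrightarrow> h p \<inter> h q \<subseteq> Y)"
  using assms
proof (induction S rule: finite_induct)
  case empty
  then show ?case by simp
next
  case (insert p S)
  have "card Y + r * card S \<le> B" using insert.prems(2) insert.hyps by simp
  then obtain h where h: "\<forall>p\<in>S. h p \<in> [W]\<^bsup>r\<^esup> \<and> Q p (h p) \<and> h p \<inter> Y = g p \<and>
    (\<forall>q\<in>S. p \<noteq> q \<longrightarrow> h p \<inter> h q \<subseteq> Y)"
    using insert.IH insert.prems by (metis insertCI)
  define Z where "Z = (Y \<union> (\<Union>q\<in>S. h q)) - g p"
  have fin: "finite (Y \<union> (\<Union>q\<in>S. h q))"
    using insert.hyps(1) insert.prems(1) h by (auto simp: nsets_def)
  have "card Z \<le> card (Y \<union> (\<Union>q\<in>S. h q))" unfolding Z_def using fin by (intro card_mono) auto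
  also have "\<dots> \<le> card Y + card (\<Union>q\<in>S. h q)" by (rule card_Un_le)
  also have "card (\<Union>q\<in>S. h q) \<le> (\<Sum>q\<in>S. card (h q))" using insert.hyps(1) by (rule card_UN_le)
  also have "\<dots> = (\<Sum>q\<in>S. r)" using h by (intro sum.cong) (auto simp: nsets_def)
  also have "card Y + \<dots> \<le> B" using \<open>card Y + r * card S \<le> B\<close> by (simp add: mult.commute)
  finally have "card Z \<le> B" by simp
  moreover have "finite Z" "Z \<inter> g p = {}" using fin by (auto simp: Z_def)
  ultimately obtain e where e: "e \<in> [W]\<^bsup>r\<^esup>" "g p \<subseteq> e" "e \<inter> Z = {}" "Q p e"
    using insert.prems(4)[of p Z] by auto
  have gY: "g p \<subseteq> Y" using insert.prems(3) by simp
  have eY: "e \<inter> Y = g p" using e(2,3) gY by (auto simp: Z_def)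
  have eh: "e \<inter> h q \<subseteq> Y" if "q \<in> S" for q using e(3) gY that by (auto simp: Z_def)
  show ?case
  proof (intro exI[of _ "h(p := e)"] ballI)
    fix q assume q: "q \<in> insert p S"
    show "(h(p := e)) q \<in> [W]\<^bsup>r\<^esup> \<and> Q q ((h(p := e)) q) \<and> (h(p := e)) q \<inter> Y = g q \<and>
      (\<forall>q'\<in>insert p S. q \<noteq> q' \<longrightarrow> (h(p := e)) q \<inter> (h(p := e)) q' \<subseteq> Y)"
    proof (cases "q = p")
      case True
      then show ?thesis using e eY eh insert.hyps(2) by auto
    next
      case False
      then have "q \<in> S" using q by simp
      then show ?thesis using False h eh[of q] by (simp add: Int_commute)
    qed
  qed
qed

text \<open>The vertices \<open>New p j\<close> are sent to the \<open>r - 2\<close> vertices of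
  \<open>h p\<close> outside the image of \<open>p\<close>, in any order. The intersection
  conditions on \<open>h\<close> make the resulting map injective.\<close>

lemma contains_rainbow_expansionI:
  assumes F: "hedges F \<subseteq> [verts F]\<^bsup>2\<^esup>"
    and H: "\<And>i. i \<in> {1..k} \<Longrightarrow> verts (H i) = V"
    and x: "inj_on x (verts F)" "x ` verts F \<subseteq> V"
    and h: "\<And>p. p \<in> hedges F \<Longrightarrow> h p \<in> [V]\<^bsup>r\<^esup>"
      "\<And>p. p \<in> hedges F \<Longrightarrow> h p \<inter> x ` verts F = x ` p"
      "\<And>p q. p \<in> hedges F \<Longrightarrow> q \<in> hedges F \<Longrightarrow> p \<noteq> q \<Longrightarrow> h p \<inter> h q \<subseteq> x ` verts F"
    and col: "inj_on col (hedges F)" "col ` hedges F \<subseteq> {1..k}"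
      "\<And>p. p \<in> hedges F \<Longrightarrow> h p \<in> hedges (H (col p))"
  shows "contains_rainbow_copy k H (expansion r F)"
proof -
  have "\<exists>g. bij_betw g {..<r - 2} (h p - x ` p)" if p: "p \<in> hedges F" for p
  proof -
    have "finite p" "card p = 2" "p \<subseteq> verts F" using p F by (auto simp: nsets_def)
    moreover have "card (x ` p) = card p"
      using \<open>p \<subseteq> verts F\<close> x(1) by (intro card_image) (rule inj_on_subset)
    moreover have "x ` p \<subseteq> h p" using h(2)[OF p] by blast
    ultimately have "card (h p - x ` p) = r - 2" "finite (h p - x ` p)"
      using h(1)[OF p] by (auto simp: nsets_def card_Diff_subset)
    then show ?thesis
      using finite_same_card_bij[of "{..<r - 2}" "h p - x ` p"] by auto
  qed
  then obtain g where g: "\<And>p. p \<in> hedges F \<Longrightarrow> bij_betw (g p) {..<r - 2} (h p - x ` p)"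
    by metis
  define f where "f = case_exp_vertex x g"
  define E where "E p = Old ` p \<union> New p ` {..<r - 2}" for p :: "'a set"
  have vE: "Old -` E p = p" for p by (auto simp: E_def)
  have new: "g p j \<in> h p" "g p j \<notin> x ` verts F" if "p \<in> hedges F" "j < r - 2" for p j
  proof -
    have "g p j \<in> h p - x ` p" using g[OF that(1)] that(2) by (auto simp: bij_betw_def)
    then show "g p j \<in> h p" "g p j \<notin> x ` verts F" using h(2)[OF that(1)] by auto
  qed
  have fE: "f ` E p = h p" if p: "p \<in> hedges F" for p
  proof -
    have "f ` E p = x ` p \<union> g p ` {..<r - 2}"
      by (simp add: E_def f_def image_Un image_image)
    also have "\<dots> = x ` p \<union> (h p - x ` p)" using g[OF p] by (simp add: bij_betw_def)
    also have "\<dots> = h p" using h(2)[OF p] by blast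
    finally show ?thesis .
  qed
  have verts_eq: "verts (expansion r F) = Old ` verts F \<union> (\<Union>e\<in>hedges F. New e ` {..<r - 2})"
    and hedges_eq: "hedges (expansion r F) = E ` hedges F"
    by (simp_all add: expansion_def E_def)
  have "inj_on f (verts (expansion r F))"
  proof (rule inj_onI)
    fix a b assume a: "a \<in> verts (expansion r F)" and b: "b \<in> verts (expansion r F)"
      and eq: "f a = f b"
    show "a = b"
    proof (cases a)
      case a': (Old u)
      then have u: "u \<in> verts F" using a by (auto simp: verts_eq)
      show ?thesis
      proof (cases b)
        case (Old v)
        then show ?thesis using a' u b eq x(1) by (auto simp: verts_eq f_def inj_on_def)
      next
        case (New q j)
        then have "q \<in> hedges F" "j < r - 2" using b by (auto simp: verts_eq)
        then show ?thesis using new(2)[of q j] eq New a' u imageI[of u "verts F" x] by (simp add: f_def)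
      qed
    next
      case a': (New p i)
      then have p: "p \<in> hedges F" "i < r - 2" using a by (auto simp: verts_eq)
      show ?thesis
      proof (cases b)
        case (Old v)
        then have "v \<in> verts F" using b by (auto simp: verts_eq)
        then show ?thesis using new(2)[OF p] eq Old a' by (auto simp: f_def)
      next
        case b': (New q j)
        then have q: "q \<in> hedges F" "j < r - 2" using b by (auto simp: verts_eq)
        have gg: "g p i = g q j" using eq a' b' by (simp add: f_def)
        have "p = q" using h(3)[OF p(1) q(1)] new[OF p] new[OF q] gg by auto
        moreover from this have "i = j"
          using gg g[OF p(1)] p(2) q(2) by (auto simp: bij_betw_def inj_on_def)
        ultimately show ?thesis using a' b' by simp
      qed
    qed
  qed
  \<comment> \<open>The preimage under \<open>Old\<close> recovers the edge of \<open>F\<close> from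
    its expanded hyperedge, so \<open>col\<close> transfers to the expansion.\<close>
  moreover have "inj_on (\<lambda>e. col (Old -` e)) (hedges (expansion r F))"
    using col(1) by (auto simp: hedges_eq inj_on_def vE)
  moreover have "(\<lambda>e. col (Old -` e)) ` hedges (expansion r F) \<subseteq> {1..k}"
    using col(2) by (auto simp: hedges_eq vE)
  moreover have "f ` verts (expansion r F) \<subseteq> V"
  proof -
    have "g p j \<in> V" if "p \<in> hedges F" "j < r - 2" for p j
      using new(1)[OF that] h(1)[OF that(1)] by (auto simp: nsets_def)
    then show ?thesis using x(2) by (auto simp: verts_eq f_def)
  qed
  moreover have "\<forall>e\<in>hedges (expansion r F). f ` e \<in> hedges (H (col (Old -` e)))"
    using col(3) fE by (auto simp: hedges_eq vE)
  ultimately show ?thesis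
    unfolding contains_rainbow_copy_def using H by blast
qed

text \<open>The pair \<open>x 0\<close>, \<open>x 1\<close> needs no robust colours, as
  \<open>e0\<close> itself will be its hyperedge. The later vertices come from
  \<open>robust_extension\<close> with \<open>K\<close> the vertices placed so far; putting
  \<open>e0\<close> into \<open>Z\<close> ensures that \<open>e0\<close> meets the clique in
  \<open>x 0\<close> and \<open>x 1\<close> only.\<close>

lemma robust_clique:
  assumes "finite W" "r \<ge> 3" "finite I" "\<And>e. C e \<subseteq> I" "e0 \<in> [W]\<^bsup>r\<^esup>"
    and deg: "\<And>u. u \<in> W \<Longrightarrow>
      M * ((card W - 1) choose (r - 1)) \<le> (\<Sum>e\<in>{e \<in> [W]\<^bsup>r\<^esup>. u \<in> e}. card (C e))"
    and big: "card W > (l + r) + l * (M + 2 * card I * B * r + (l + r) * card I)"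
    and t: "2 \<le> t" "t \<le> l"
  shows "\<exists>x. inj_on x {..<t} \<and> x ` {..<t} \<subseteq> W \<and> x 0 \<in> e0 \<and> x 1 \<in> e0 \<and> x ` {2..<t} \<inter> e0 = {} \<and>
    (\<forall>m\<in>{2..<t}. m * M \<le> (\<Sum>i<m. card (robust_colours C r B W {x i, x m})))"
  using t
proof (induction t rule: dec_induct)
  case base
  have e0: "finite e0" "card e0 = r" "e0 \<subseteq> W" using assms(5) by (auto simp: nsets_def)
  have "\<not> card e0 \<le> Suc 0" using e0 assms(2) by simp
  then obtain a b where "a \<in> e0" "b \<in> e0" "a \<noteq> b" using card_le_Suc0_iff_eq[OF e0(1)] by blast
  then show ?case
    using e0(3) by (intro exI[of _ "\<lambda>i. if i = 0 then a else b"])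
      (auto simp: inj_on_def numeral_2_eq_2 less_Suc_eq)
next
  case (step t)
  then obtain x where x: "inj_on x {..<t}" "x ` {..<t} \<subseteq> W" "x 0 \<in> e0" "x 1 \<in> e0" "x ` {2..<t} \<inter> e0 = {}"
    "\<forall>m\<in>{2..<t}. m * M \<le> (\<Sum>i<m. card (robust_colours C r B W {x i, x m}))" by auto
  define K where "K = x ` {..<t}"
  define Z where "Z = e0 \<union> K"
  have e0: "finite e0" "card e0 = r" "e0 \<subseteq> W" using assms(5) by (auto simp: nsets_def)
  have cK: "card K = t" unfolding K_def using x(1) by (simp add: card_image)
  have cZ: "card Z \<le> l + r" using card_Un_le[of e0 K] cK e0(2) step.prems by (simp add: Z_def)
  have "card Z + card K * (M + 2 * card I * B * r + card Z * card I)
    \<le> (l + r) + l * (M + 2 * card I * B * r + (l + r) * card I)"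
    using cZ cK step.prems by (intro add_mono mult_le_mono) auto
  then have "\<exists>v\<in>W - Z. card K * M \<le> (\<Sum>u\<in>K. card (robust_colours C r B W {u,v}))"
  proof (intro robust_extension[where I = I])
    show "r \<le> card W" using e0 assms(1) card_mono by metis
    show "K \<noteq> {}" using cK step.hyps by auto
  qed (use assms x e0 in \<open>auto simp: K_def Z_def\<close>)
  then obtain v where v: "v \<in> W" "v \<notin> e0" "v \<notin> K"
    "card K * M \<le> (\<Sum>u\<in>K. card (robust_colours C r B W {u,v}))" by (auto simp: Z_def)
  have sumK: "(\<Sum>u\<in>K. card (robust_colours C r B W {u,v})) = (\<Sum>i<t. card (robust_colours C r B W {x i, v}))"
    unfolding K_def using x(1) by (simp add: sum.reindex)
  let ?x = "x(t := v)"
  have "inj_on ?x {..<Suc t}" using x(1) v(3) by (auto simp: inj_on_def K_def less_Suc_eq)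
  moreover have "?x ` {..<Suc t} \<subseteq> W" using x(2) v(1) by (auto simp: less_Suc_eq)
  moreover have "?x 0 \<in> e0" "?x 1 \<in> e0" using x(3,4) step.hyps by auto
  moreover have "?x ` {2..<Suc t} \<inter> e0 = {}"
    using x(5) v(2) by (fastforce simp: less_Suc_eq)
  moreover have "\<forall>m\<in>{2..<Suc t}. m * M \<le> (\<Sum>i<m. card (robust_colours C r B W {?x i, ?x m}))"
  proof
    fix m assume m: "m \<in> {2..<Suc t}"
    show "m * M \<le> (\<Sum>i<m. card (robust_colours C r B W {?x i, ?x m}))"
    proof (cases "m = t")
      case True
      then show ?thesis using v(4) cK sumK by simp
    next
      case False
      then have m': "m \<in> {2..<t}" using m by auto
      then have "(\<Sum>i<m. card (robust_colours C r B W {?x i, ?x m})) = (\<Sum>i<m. card (robust_colours C r B W {x i, x m}))"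
        by (intro sum.cong) auto
      then show ?thesis using x(6) m' by simp
    qed
  qed
  ultimately show ?case by blast
qed

text \<open>Group the pairs by their larger index \<open>m\<close>: row \<open>m\<close> consists of
  \<open>m\<close> pairs with average at least \<open>(l choose 2) - 1\<close>, so
  \<open>few_small_weights\<close> bounds its small pairs, and
  \<open>few_small_weights_total\<close> adds up the rows.\<close>

lemma clique_colouring:
  fixes x :: "nat \<Rightarrow> 'a" and w :: "'a set \<Rightarrow> 'c set"
  assumes l: "l \<ge> 3" and k: "k = (l choose 2) - 1 + q" and q: "2 * q \<le> l" "q \<ge> 1"
    and fin: "finite D" "\<And>P. finite (w P)" "\<And>P. card (w P) \<le> k"
    and D: "card D \<ge> (l choose 2)"
    and rows: "\<And>m. m \<in> {2..<l} \<Longrightarrow> m * ((l choose 2) - 1) \<le> (\<Sum>i<m. card (w {x i, x m}))"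
  shows "\<exists>col. inj_on col ([{..<l}]\<^bsup>2\<^esup>) \<and> col {0,1} \<in> D \<and>
    (\<forall>p\<in>[{..<l}]\<^bsup>2\<^esup>. p \<noteq> {0,1} \<longrightarrow> col p \<in> w (x ` p))"
proof -
  let ?P = "[{..<l}]\<^bsup>2\<^esup>"
  define A where "A p = (if p = {0,1} then D else w (x ` p))" for p :: "nat set"
  have fP: "finite ?P" by (simp add: finite_imp_finite_nsets)
  have "\<exists>col. inj_on col ?P \<and> (\<forall>p\<in>?P. col p \<in> A p)"
  proof (rule distinct_representatives[OF fP])
    show "finite (A p)" for p using fin by (simp add: A_def)
    fix s assume "s < card ?P"
    then have s: "s < (l choose 2)" by simp
    define small where "small m = {i \<in> {..<m}. card (w {x i, x m}) \<le> s}" for m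
    have "{p \<in> ?P. card (A p) \<le> s} \<subseteq> (\<Union>m\<in>{2..<l}. (\<lambda>i. {i,m}) ` small m)"
    proof
      fix p assume p: "p \<in> {p \<in> ?P. card (A p) \<le> s}"
      then obtain i m where im: "p = {i,m}" "i < m" "m < l"
        by (auto simp: ordered_nsets_2_eq)
      \<comment> \<open>As \<open>card D \<ge> (l choose 2) > s\<close>, the special pair is never
        small. It is the only pair in row 1, so the rows start at 2.\<close>
      have "p \<noteq> {0,1}" using p D s by (auto simp: A_def)
      then have "m \<noteq> 1" using im by auto
      then have "m \<in> {2..<l}" using im by auto
      moreover have "i \<in> small m" using p im \<open>p \<noteq> {0,1}\<close> by (auto simp: small_def A_def)
      ultimately show "p \<in> (\<Union>m\<in>{2..<l}. (\<lambda>i. {i,m}) ` small m)" using im(1) by blast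
    qed
    then have "card {p \<in> ?P. card (A p) \<le> s} \<le> card (\<Union>m\<in>{2..<l}. (\<lambda>i. {i,m}) ` small m)"
      by (intro card_mono) (auto simp: small_def)
    also have "\<dots> \<le> (\<Sum>m\<in>{2..<l}. card ((\<lambda>i. {i,m}) ` small m))"
      by (intro card_UN_le) simp
    also have "\<dots> \<le> (\<Sum>m\<in>{2..<l}. card (small m))"
      by (intro sum_mono card_image_le) (simp add: small_def)
    also have "\<dots> \<le> s"
    proof (rule few_small_weights_total[OF l k q s])
      fix m assume m: "m \<in> {2..<l}"
      show "card (small m) \<le> m"
        using card_mono[of "{..<m}" "small m"] by (auto simp: small_def)
      show "card (small m) * (k - s) \<le> m * q"
        using few_small_weights[of "{..<m}" "\<lambda>i. card (w {x i, x m})" k s "(l choose 2) - 1"]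
          rows[OF m] fin(3) s k by (simp add: small_def)
    qed
    finally show "card {p \<in> ?P. card (A p) \<le> s} \<le> s" .
  qed
  then obtain col where col: "inj_on col ?P" "\<forall>p\<in>?P. col p \<in> A p" by blast
  moreover have "{0,1} \<in> ?P" using l by simp
  ultimately show ?thesis unfolding A_def by (metis (no_types, lifting))
qed

text \<open>The value of \<open>B\<close> allows for the clique and \<open>e0\<close>, at most
  \<open>l + r\<close> vertices, and for \<open>r\<close> vertices in each of the at most
  \<open>l choose 2\<close> hyperedges chosen by \<open>disjoint_links\<close>.\<close>

lemma rainbow_clique_links:
  fixes C :: "'a set \<Rightarrow> 'c set"
  assumes r: "r \<ge> 3" and l: "l \<ge> 3" and k: "card I = (l choose 2) - 1 + q" and q: "2 * q \<le> l" "q \<ge> 1"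
    and W: "finite W" and I: "finite I" "\<And>e. C e \<subseteq> I"
    and e0: "e0 \<in> [W]\<^bsup>r\<^esup>" "card (C e0) \<ge> (l choose 2)"
    and deg: "\<And>u. u \<in> W \<Longrightarrow> ((l choose 2) - 1) * ((card W - 1) choose (r - 1))
      \<le> (\<Sum>e\<in>{e \<in> [W]\<^bsup>r\<^esup>. u \<in> e}. card (C e))"
    and B: "B = l + r + r * (l choose 2)"
    and big: "card W > (l + r) + l * ((l choose 2) - 1 + 2 * card I * B * r + (l + r) * card I)"
  obtains x col h where "inj_on x {..<l}" "x ` {..<l} \<subseteq> W" "inj_on col ([{..<l}]\<^bsup>2\<^esup>)"
    "\<And>p. p \<in> [{..<l}]\<^bsup>2\<^esup> \<Longrightarrow> h p \<in> [W]\<^bsup>r\<^esup> \<and> h p \<inter> x ` {..<l} = x ` p \<and> col p \<in> C (h p)"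
    "\<And>p p'. p \<in> [{..<l}]\<^bsup>2\<^esup> \<Longrightarrow> p' \<in> [{..<l}]\<^bsup>2\<^esup> \<Longrightarrow> p \<noteq> p' \<Longrightarrow> h p \<inter> h p' \<subseteq> x ` {..<l}"
proof -
  let ?P = "[{..<l}]\<^bsup>2\<^esup>" and ?R = "robust_colours C r B W"
  have "2 \<le> l" using l by simp
  from robust_clique[OF W r I e0(1) deg big this order_refl]
  obtain x where x: "inj_on x {..<l}" "x ` {..<l} \<subseteq> W" "x 0 \<in> e0" "x 1 \<in> e0" "x ` {2..<l} \<inter> e0 = {}"
    "\<forall>m\<in>{2..<l}. m * ((l choose 2) - 1) \<le> (\<Sum>i<m. card (?R {x i, x m}))" by blast
  have RI: "?R P \<subseteq> I" for P by (rule robust_colours_subset) (rule I)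
  have "\<exists>col. inj_on col ?P \<and> col {0,1} \<in> C e0 \<and> (\<forall>p\<in>?P. p \<noteq> {0,1} \<longrightarrow> col p \<in> ?R (x ` p))"
  proof (rule clique_colouring[OF l k q])
    show "finite (C e0)" using finite_subset[OF I(2) I(1)] .
    show "finite (?R P)" for P using finite_subset[OF RI I(1)] .
    show "card (?R P) \<le> card I" for P using card_mono[OF I(1) RI] .
  qed (use x(6) e0(2) in auto)
  then obtain col where col: "inj_on col ?P" "col {0,1} \<in> C e0"
    "\<And>p. p \<in> ?P \<Longrightarrow> p \<noteq> {0,1} \<Longrightarrow> col p \<in> ?R (x ` p)" by blast
  \<comment> \<open>Including \<open>e0\<close> keeps the hyperedges of the other pairs away from
    the part of \<open>e0\<close> outside the clique, so that \<open>e0\<close> can be added as the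
    hyperedge of \<open>{0,1}\<close>.\<close>
  define Y where "Y = x ` {..<l} \<union> e0"
  have fe0: "finite e0" "card e0 = r" using e0(1) by (auto simp: nsets_def)
  have fP: "finite ?P" by (simp add: finite_imp_finite_nsets)
  have "\<exists>h. \<forall>p\<in>?P - {{0,1}}. h p \<in> [W]\<^bsup>r\<^esup> \<and> col p \<in> C (h p) \<and> h p \<inter> Y = x ` p \<and>
    (\<forall>q\<in>?P - {{0,1}}. p \<noteq> q \<longrightarrow> h p \<inter> h q \<subseteq> Y)"
  proof (rule disjoint_links)
    show "finite (?P - {{0,1}})" using fP by simp
    show "finite Y" using fe0 by (simp add: Y_def)
    have "card Y \<le> l + r"
      using card_Un_le[of "x ` {..<l}" e0] card_image_le[of "{..<l}" x] fe0 by (simp add: Y_def)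
    moreover have "card (?P - {{0,1}}) \<le> (l choose 2)"
      using card_mono[OF fP, of "?P - {{0,1}}"] by auto
    ultimately show "card Y + r * card (?P - {{0,1}}) \<le> B"
      unfolding B by (intro add_mono mult_left_mono) auto
    show "x ` p \<subseteq> Y" if "p \<in> ?P - {{0,1}}" for p using that by (auto simp: nsets_def Y_def)
    show "\<exists>e\<in>[W]\<^bsup>r\<^esup>. x ` p \<subseteq> e \<and> e \<inter> Z = {} \<and> col p \<in> C e"
      if "p \<in> ?P - {{0,1}}" "finite Z" "card Z \<le> B" "Z \<inter> x ` p = {}" for p Z
      using col(3)[of p] that by (simp add: robust_colours_def)
  qed
  then obtain h where "\<forall>p\<in>?P - {{0,1}}. h p \<in> [W]\<^bsup>r\<^esup> \<and> col p \<in> C (h p) \<and> h p \<inter> Y = x ` p \<and>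
    (\<forall>q\<in>?P - {{0,1}}. p \<noteq> q \<longrightarrow> h p \<inter> h q \<subseteq> Y)" ..
  note h = bspec[OF this]
  define h' where "h' = h({0,1} := e0)"
  have e0x: "e0 \<inter> x ` {..<l} = x ` {0,1}"
  proof -
    have "{..<l} = {0,1} \<union> {2..<l}" using l by auto
    then show ?thesis using x(3-5) by auto
  qed
  have xp: "x ` p \<subseteq> x ` {..<l}" if "p \<in> ?P" for p using that by (auto simp: nsets_def)
  have hx: "h p \<inter> x ` {..<l} = x ` p" "h p \<inter> e0 \<subseteq> x ` {..<l}" if "p \<in> ?P - {{0,1}}" for p
  proof -
    have "h p \<inter> (x ` {..<l} \<union> e0) = x ` p" using h[OF that] by (simp add: Y_def)
    moreover have "x ` p \<subseteq> x ` {..<l}" using xp that by simp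
    ultimately show "h p \<inter> x ` {..<l} = x ` p" "h p \<inter> e0 \<subseteq> x ` {..<l}" by blast+
  qed
  have hh: "h p \<inter> h p' \<subseteq> x ` {..<l}" if "p \<in> ?P - {{0,1}}" "p' \<in> ?P - {{0,1}}" "p \<noteq> p'" for p p'
  proof -
    have "h p \<inter> h p' \<subseteq> x ` {..<l} \<union> e0" using h[OF that(1)] that(2,3) by (simp add: Y_def)
    then show ?thesis using hx(2)[OF that(1)] by blast
  qed
  show ?thesis
  proof (rule that[OF x(1,2) col(1), of h'])
    fix p assume p: "p \<in> ?P"
    show "h' p \<in> [W]\<^bsup>r\<^esup> \<and> h' p \<inter> x ` {..<l} = x ` p \<and> col p \<in> C (h' p)"
    proof (cases "p = {0,1}")
      case True
      show ?thesis unfolding True using e0(1) e0x col(2) by (simp add: h'_def)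
    next
      case False
      then have "p \<in> ?P - {{0,1}}" using p by simp
      then show ?thesis using False h[of p] hx(1)[of p] by (simp add: h'_def)
    qed
    fix p' assume p': "p' \<in> ?P" "p \<noteq> p'"
    consider "p = {0,1}" "p' \<in> ?P - {{0,1}}" | "p \<in> ?P - {{0,1}}" "p' = {0,1}"
      | "p \<in> ?P - {{0,1}}" "p' \<in> ?P - {{0,1}}"
      using p p' by fastforce
    then show "h' p \<inter> h' p' \<subseteq> x ` {..<l}"
    proof cases
      case 1
      then have "h' p = e0" "h' p' = h p'" by (simp_all add: h'_def)
      then show ?thesis using hx(2)[OF 1(2)] by blast
    next
      case 2
      then have "h' p' = e0" "h' p = h p" by (simp_all add: h'_def)
      then show ?thesis using hx(2)[OF 2(1)] by blast
    next
      case 3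
      then have "h' p = h p" "h' p' = h p'" by (simp_all add: h'_def)
      then show ?thesis using hh[OF 3 p'(2)] by simp
    qed
  qed
qed

section \<open>Upper and lower bounds for the rainbow sums\<close>

lemma card_hedges_expansion: "card (hedges (expansion r F)) = card (hedges F)"
proof -
  have "Old -` (Old ` e \<union> New e ` {..<r - 2}) = e" for e :: "'a set" by auto
  then have "inj_on (\<lambda>e :: 'a set. Old ` e \<union> New e ` {..<r - 2}) (hedges F)"
    by (metis (no_types, lifting) inj_onI)
  then show ?thesis by (simp add: expansion_def card_image)
qed

lemma rainbow_sum_le:
  assumes r: "r \<ge> 3" and l: "l \<ge> 3" and k: "k = (l choose 2) - 1 + q" and q: "2 * q \<le> l" "q \<ge> 1"
  shows "\<exists>n0. \<forall>n\<ge>n0. \<forall>s\<in>rainbow_sums r n k (expansion r (complete_graph l)).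
    s \<le> ((l choose 2) - 1) * (n choose r)"
proof -
  define M where "M = (l choose 2) - 1"
  define B where "B = l + r + r * (l choose 2)"
  \<comment> \<open>One more than the threshold \<open>big\<close> of
    \<open>rainbow_clique_links\<close> for \<open>k\<close> colours. Starting from
    \<open>n1 + k * (n1 choose r)\<close> vertices, \<open>high_min_degree_subset\<close> with
    excess 0 keeps at least \<open>n1\<close> of them.\<close>
  define n1 where "n1 = Suc ((l + r) + l * (M + 2 * k * B * r + (l + r) * k))"
  have "s \<le> M * (n choose r)"
    if n: "n \<ge> n1 + k * (n1 choose r)" and s: "s \<in> rainbow_sums r n k (expansion r (complete_graph l))" for n s
  proof (rule ccontr)
    assume "\<not> s \<le> M * (n choose r)"
    obtain H :: "nat \<Rightarrow> nat hypergraph" where H: "s = (\<Sum>i=1..k. card (hedges (H i)))"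
      "\<forall>i\<in>{1..k}. r_graph r (H i) \<and> verts (H i) = {..<n}"
      "\<not> contains_rainbow_copy k H (expansion r (complete_graph l))"
      using s by (auto simp: rainbow_sums_def)
    define C where "C e = {i \<in> {1..k}. e \<in> hedges (H i)}" for e
    have C: "C e \<subseteq> {1..k}" for e by (auto simp: C_def)
    have Ck: "card (C e) \<le> k" for e using card_mono[OF _ C[of e]] by simp
    have "(\<Sum>e\<in>[{..<n}]\<^bsup>r\<^esup>. card (C e)) = (\<Sum>i=1..k. card {e \<in> [{..<n}]\<^bsup>r\<^esup>. i \<in> C e})"
      by (rule sum_card_swap) (auto simp: finite_imp_finite_nsets C_def)
    also have "\<dots> = s" unfolding H(1)
    proof (intro sum.cong arg_cong[where f = card])
      fix i assume i: "i \<in> {1..k}"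
      then have "hedges (H i) \<subseteq> [{..<n}]\<^bsup>r\<^esup>" using H(2) unfolding r_graph_def by metis
      then show "{e \<in> [{..<n}]\<^bsup>r\<^esup>. i \<in> C e} = hedges (H i)" using i by (auto simp: C_def)
    qed simp
    finally have "M * (card {..<n} choose r) + 0 < (\<Sum>e\<in>[{..<n}]\<^bsup>r\<^esup>. card (C e))"
      using \<open>\<not> s \<le> M * (n choose r)\<close> by simp
    then have "\<exists>W\<subseteq>{..<n}. card W \<ge> n1 \<and> M * (card W choose r) < (\<Sum>e\<in>[W]\<^bsup>r\<^esup>. card (C e)) \<and>
      (\<forall>u\<in>W. M * ((card W - 1) choose (r - 1)) \<le> (\<Sum>e\<in>{e \<in> [W]\<^bsup>r\<^esup>. u \<in> e}. card (C e)))"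
      using n r Ck by (intro high_min_degree_subset[where j = 0 and k = k]) auto
    then obtain W where W: "W \<subseteq> {..<n}" "card W \<ge> n1" "M * (card W choose r) < (\<Sum>e\<in>[W]\<^bsup>r\<^esup>. card (C e))"
      "\<And>u. u \<in> W \<Longrightarrow> M * ((card W - 1) choose (r - 1)) \<le> (\<Sum>e\<in>{e \<in> [W]\<^bsup>r\<^esup>. u \<in> e}. card (C e))"
      by blast
    have fW: "finite W" using W(1) finite_subset by blast
    \<comment> \<open>The total weight on \<open>W\<close> exceeds \<open>M\<close> times the number
      of \<open>r\<close>-sets, so some \<open>r\<close>-set lies above the average
      \<open>M\<close>.\<close>
    have "\<exists>e0\<in>[W]\<^bsup>r\<^esup>. M < card (C e0)"
    proof (rule ccontr)
      assume "\<not> ?thesis"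
      then have "(\<Sum>e\<in>[W]\<^bsup>r\<^esup>. card (C e)) \<le> card ([W]\<^bsup>r\<^esup>) * M"
        using sum_bounded_above[of "[W]\<^bsup>r\<^esup>" "\<lambda>e. card (C e)" M] by (auto simp: not_less)
      then show False using W(3) by (simp add: mult.commute)
    qed
    then obtain e0 where e0: "e0 \<in> [W]\<^bsup>r\<^esup>" "M < card (C e0)" by blast
    have "(l choose 2) \<le> card (C e0)" using e0(2) unfolding M_def by linarith
    note e0 = e0(1) this
    have kI: "card {1..k} = (l choose 2) - 1 + q" using k by simp
    have big: "(l + r) + l * ((l choose 2) - 1 + 2 * card {1..k} * B * r + (l + r) * card {1..k}) < card W"
      using W(2) by (simp add: n1_def M_def)
    have F: "verts (complete_graph l) = {..<l}" "hedges (complete_graph l) = [{..<l}]\<^bsup>2\<^esup>"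
      by (simp_all add: complete_graph_def)
    show False
    proof (rule rainbow_clique_links[OF r l kI q fW finite_atLeastAtMost C e0 W(4)[unfolded M_def] B_def big])
      fix x col h
      assume x: "inj_on x {..<l}" "x ` {..<l} \<subseteq> W" "inj_on col ([{..<l}]\<^bsup>2\<^esup>)"
        and h: "\<And>p. p \<in> [{..<l}]\<^bsup>2\<^esup> \<Longrightarrow> h p \<in> [W]\<^bsup>r\<^esup> \<and> h p \<inter> x ` {..<l} = x ` p \<and> col p \<in> C (h p)"
        and hh: "\<And>p p'. p \<in> [{..<l}]\<^bsup>2\<^esup> \<Longrightarrow> p' \<in> [{..<l}]\<^bsup>2\<^esup> \<Longrightarrow> p \<noteq> p' \<Longrightarrow> h p \<inter> h p' \<subseteq> x ` {..<l}"
      have "contains_rainbow_copy k H (expansion r (complete_graph l))"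
      proof (rule contains_rainbow_expansionI[where V = "{..<n}" and x = x and h = h and col = col]; (unfold F)?)
        show "h p \<in> [{..<n}]\<^bsup>r\<^esup>" if "p \<in> [{..<l}]\<^bsup>2\<^esup>" for p
          using h[OF that] nsets_mono[OF W(1), of r] by blast
        show "col ` [{..<l}]\<^bsup>2\<^esup> \<subseteq> {1..k}"
          using h C by blast
        show "h p \<in> hedges (H (col p))" if "p \<in> [{..<l}]\<^bsup>2\<^esup>" for p
          using h[OF that] by (simp add: C_def)
        show "verts (H i) = {..<n}" if "i \<in> {1..k}" for i using H(2) that by blast
        show "x ` {..<l} \<subseteq> {..<n}" using x(2) W(1) by blast
        show "h p \<inter> x ` {..<l} = x ` p" if "p \<in> [{..<l}]\<^bsup>2\<^esup>" for p using h[OF that] by blast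
      qed (fact x hh order_refl)+
      with H(3) show False by blast
    qed
  qed
  then show ?thesis unfolding M_def by blast
qed

lemma rainbow_sum_le_trivial:
  assumes "s \<in> rainbow_sums r n k F"
  shows "s \<le> k * (n choose r)"
proof -
  obtain H :: "nat \<Rightarrow> nat hypergraph" where s: "s = (\<Sum>i=1..k. card (hedges (H i)))"
    and H: "\<And>i. i \<in> {1..k} \<Longrightarrow> r_graph r (H i) \<and> verts (H i) = {..<n}"
    using assms by (auto simp: rainbow_sums_def)
  have "card (hedges (H i)) \<le> n choose r" if "i \<in> {1..k}" for i
  proof -
    have "hedges (H i) \<subseteq> [{..<n}]\<^bsup>r\<^esup>" using H[OF that] unfolding r_graph_def by metis
    then have "card (hedges (H i)) \<le> card ([{..<n}]\<^bsup>r\<^esup>)"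
      by (intro card_mono finite_imp_finite_nsets) auto
    then show ?thesis by simp
  qed
  then show ?thesis unfolding s using sum_bounded_above[of "{1..k}" "\<lambda>i. card (hedges (H i))" "n choose r"] by simp
qed

text \<open>The extremal construction: \<open>j\<close> complete hypergraphs and otherwise empty
  ones. A rainbow copy would need \<open>card (hedges F)\<close> distinct colours, but only
  \<open>j\<close> occur.\<close>

lemma complete_colours_in_rainbow_sums:
  assumes "j \<le> k" "j < card (hedges F)"
  shows "j * (n choose r) \<in> rainbow_sums r n k F"
proof -
  define H :: "nat \<Rightarrow> nat hypergraph" where "H i = ({..<n}, if i \<le> j then [{..<n}]\<^bsup>r\<^esup> else {})" for i
  have "(\<Sum>i=1..k. card (hedges (H i))) = (\<Sum>i=1..j. card (hedges (H i)))"
    using assms(1) by (intro sum.mono_neutral_right) (auto simp: H_def)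
  also have "\<dots> = j * (n choose r)" by (simp add: H_def)
  finally have sum_eq: "j * (n choose r) = (\<Sum>i=1..k. card (hedges (H i)))" by simp
  have "\<not> contains_rainbow_copy k H F"
  proof
    assume "contains_rainbow_copy k H F"
    then obtain f c where fc: "inj_on c (hedges F)" "c ` hedges F \<subseteq> {1..k}"
      "\<forall>e\<in>hedges F. f ` e \<in> hedges (H (c e))"
      unfolding contains_rainbow_copy_def by blast
    have "c e \<in> {1..j}" if "e \<in> hedges F" for e
      using fc(2,3) that by (fastforce simp: H_def split: if_splits)
    then have "card (hedges F) \<le> card {1..j}" using fc(1) by (intro card_inj_on_le[of c]) auto
    with assms(2) show False by simp
  qed
  moreover have "\<forall>i\<in>{1..k}. r_graph r (H i) \<and> verts (H i) = {..<n}"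
    by (auto simp: r_graph_def H_def)
  ultimately show ?thesis unfolding rainbow_sums_def using sum_eq by blast
qed

theorem theorem1p12:
  fixes l r k :: nat
  assumes "r \<ge> 3" and "l \<ge> r"
    and "k \<ge> 1" and "real k < ((real l)^2 - 1) / 2"
  shows "\<exists>n0. \<forall>n\<ge>n0.
    ex_sum r n k (expansion r (complete_graph l)) = min k ((l choose 2) - 1) * (n choose r)"
proof -
  let ?F = "expansion r (complete_graph l)" and ?N = "l choose 2"
  have N2: "2 * ?N = l * (l - 1)"
    unfolding choose_two by (intro dvd_mult_div_cancel) (cases l; auto)
  have l: "l \<ge> 3" using assms by simp
  have Npos: "?N > 0" using l by simp
  have F: "card (hedges ?F) = ?N"
    by (simp add: card_hedges_expansion complete_graph_def)
  have "\<exists>n0. \<forall>n\<ge>n0. \<forall>s\<in>rainbow_sums r n k ?F. s \<le> min k (?N - 1) * (n choose r)"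
  proof (cases "k \<le> ?N - 1")
    case True
    then show ?thesis using rainbow_sum_le_trivial[of _ r _ k ?F] by (simp add: min_absorb1)
  next
    case False
    define q where "q = k - (?N - 1)"
    have k: "k = ?N - 1 + q" "q \<ge> 1" using False by (auto simp: q_def)
    \<comment> \<open>In integers the bound reads \<open>2 * k + 1 < l * l = 2 * ?N + l\<close>;
      substituting \<open>k = ?N - 1 + q\<close> leaves \<open>2 * q < l + 1\<close>.\<close>
    have "2 * real k + 1 < real l * real l" using assms(4) by (simp add: power2_eq_square)
    then have "real (2 * k + 1) < real (l * l)" by simp
    then have "2 * k + 1 < l * l" by (simp only: of_nat_less_iff)
    moreover have "l * l = 2 * ?N + l" using N2 l by (cases l) auto
    ultimately have "2 * q \<le> l" using k(1) Npos by linarith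
    then show ?thesis
      using rainbow_sum_le[OF assms(1) l k(1) _ k(2)] k(1) by (simp add: min_absorb2)
  qed
  then obtain n0 where n0: "\<And>n s. n \<ge> n0 \<Longrightarrow> s \<in> rainbow_sums r n k ?F \<Longrightarrow> s \<le> min k (?N - 1) * (n choose r)"
    by blast
  have "ex_sum r n k ?F = min k (?N - 1) * (n choose r)" if "n \<ge> n0" for n
    unfolding ex_sum_def
  proof (rule Max_eqI)
    show "min k (?N - 1) * (n choose r) \<in> rainbow_sums r n k ?F"
    proof (rule complete_colours_in_rainbow_sums)
      show "min k (?N - 1) < card (hedges ?F)" unfolding F using Npos by linarith
    qed simp
    show "finite (rainbow_sums r n k ?F)" by (rule finite_rainbow_sums)
  qed (use n0 that in auto)
  then show ?thesis by blast
qed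

end
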